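(* For any positive integers $m$, $n$ and $b$, there exists a maximal cross resolvable design $(X,\mathcal{A})$ with $X=\{1,2,\ldots,nb^m\}$, $|\mathcal{A}|=mb$, $m$ parallel classes, $b$ blocks in each parallel class, and $m$-th cross intersection number $\mu_m=n$.
   Context: A design $(X,\mathcal{A})$ is an ordered pair of two finite sets: a set $X$, whose elements are called points, and a set $\mathcal{A}$ of subsets of $X$, whose elements are called blocks, such that any two blocks contain the same number of points. A parallel class of $(X,\mathcal{A})$ is a subset of $\mathcal{A}$ that partitions $X$. The design is resolvable if, for some positive integer $m$, it has $m$ parallel classes $\mathcal{P}_1,\dots,\mathcal{P}_m$ which partition $\mathcal{A}$. Any two parallel classes have the same number of blocks, denoted $b$; for some ordering, denote the blocks of $\mathcal{P}_i$ by $B(i,1),\dots,B(i,b)$. A resolvable design with $m$ parallel classes is called a maximal cross resolvable design if for some positive integer $\mu_m$ (called the $m$-th cross intersection number) any $m$ blocks chosen from the $m$ distinct parallel classes have $\mu_m$ points in common, i.e. $|\bigcap_{i=1}^m B(i,j_i)|=\mu_m$ for all $1\le j_1,\dots,j_m\le b$.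
   Formalization: For b = 1 and m ≥ 2 the claim fails for a set of blocks (the only one-block parallel class is {X}, so |A| = 1, not m); blocks are therefore taken as a multiset, and A is proved to be a genuine set whenever b > 1 or m = 1. *)

theory Defs
  imports Complex_Main "HOL-Library.Multiset" "HOL-Library.Disjoint_Sets"
begin

text \<open>
  The blocks of a design form a multiset, so that a block may be repeated. With a set of blocks
  the case of one block per parallel class would be degenerate: the only such class is \<open>{X}\<close>, and
  two of them cannot be disjoint. A design whose blocks form a set \<open>\<A>\<close> is the case \<open>mset_set \<A>\<close>;
  the lemmas \<open>design_mset_set\<close>, \<open>parallel_class_mset_set\<close> and \<open>resolution_mset_set\<close> give the
  notions in that case.
\<close>

definition design :: "'a set \<Rightarrow> 'a set multiset \<Rightarrow> bool" where
  "design X A \<longleftrightarrow> finite X \<and> (\<forall>B\<in>#A. B \<subseteq> X) \<and> (\<forall>B\<in>#A. \<forall>C\<in>#A. card B = card C)"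

definition parallel_class :: "'a set \<Rightarrow> 'a set multiset \<Rightarrow> 'a set set \<Rightarrow> bool" where
  "parallel_class X A P \<longleftrightarrow> finite P \<and> mset_set P \<subseteq># A \<and> partition_on X P"

definition resolution :: "'a set \<Rightarrow> 'a set multiset \<Rightarrow> nat \<Rightarrow> (nat \<Rightarrow> 'a set set) \<Rightarrow> bool" where
  "resolution X A m P \<longleftrightarrow>
     m > 0 \<and> (\<forall>i\<in>{1..m}. parallel_class X A (P i)) \<and> A = (\<Sum>i\<in>{1..m}. mset_set (P i))"

definition cross_intersection_number :: "nat \<Rightarrow> (nat \<Rightarrow> 'a set set) \<Rightarrow> nat \<Rightarrow> bool" where
  "cross_intersection_number m P \<mu> \<longleftrightarrow>
     (\<forall>B. (\<forall>i\<in>{1..m}. B i \<in> P i) \<longrightarrow> card (\<Inter>i\<in>{1..m}. B i) = \<mu>)"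

definition maximal_cross_resolvable ::
    "'a set \<Rightarrow> 'a set multiset \<Rightarrow> nat \<Rightarrow> (nat \<Rightarrow> 'a set set) \<Rightarrow> bool" where
  "maximal_cross_resolvable X A m P \<longleftrightarrow>
     design X A \<and> resolution X A m P \<and> (\<exists>\<mu>>0. cross_intersection_number m P \<mu>)"

lemma design_mset_set:
  assumes "finite \<A>"
  shows "design X (mset_set \<A>) \<longleftrightarrow>
    finite X \<and> (\<forall>B\<in>\<A>. B \<subseteq> X) \<and> (\<forall>B\<in>\<A>. \<forall>C\<in>\<A>. card B = card C)"
  using assms by (simp add: design_def)

lemma parallel_class_mset_set:
  assumes "finite \<A>"
  shows "parallel_class X (mset_set \<A>) P \<longleftrightarrow> P \<subseteq> \<A> \<and> partition_on X P"
  using assms msubset_mset_set_iff[of P \<A>] finite_subset[of P \<A>]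
  unfolding parallel_class_def by blast

lemma resolution_mset_set:
  assumes "finite \<A>"
  shows "resolution X (mset_set \<A>) m P \<longleftrightarrow>
    m > 0 \<and> (\<forall>i\<in>{1..m}. P i \<subseteq> \<A> \<and> partition_on X (P i)) \<and>
    disjoint_family_on P {1..m} \<and> (\<Union>i\<in>{1..m}. P i) = \<A>"
proof -
  have "mset_set \<A> = (\<Sum>i\<in>{1..m}. mset_set (P i)) \<longleftrightarrow>
      disjoint_family_on P {1..m} \<and> (\<Union>i\<in>{1..m}. P i) = \<A>"
    if sub: "\<forall>i\<in>{1..m}. P i \<subseteq> \<A>"
  proof -
    have fin: "finite (P i)" if "i \<in> {1..m}" for i
      using sub that assms finite_subset by blast
    have cnt: "count (\<Sum>i\<in>{1..m}. mset_set (P i)) x = card {i\<in>{1..m}. x \<in> P i}" for x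
    proof -
      have "count (\<Sum>i\<in>{1..m}. mset_set (P i)) x = (\<Sum>i\<in>{1..m}. if x \<in> P i then 1 else 0)"
        using fin by (auto simp: count_sum count_mset_set' intro!: sum.cong)
      also have "\<dots> = card {i\<in>{1..m}. x \<in> P i}"
        by (simp add: sum.If_cases Int_def)
      finally show ?thesis .
    qed
    show ?thesis
    proof
      assume eq: "mset_set \<A> = (\<Sum>i\<in>{1..m}. mset_set (P i))"
      have c: "card {i\<in>{1..m}. x \<in> P i} = (if x \<in> \<A> then 1 else 0)" for x
        using cnt[of x] assms unfolding eq[symmetric] count_mset_set' by simp
      have "P i \<inter> P j = {}" if "i \<in> {1..m}" "j \<in> {1..m}" "i \<noteq> j" for i j
      proof (rule ccontr)
        assume "P i \<inter> P j \<noteq> {}"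
        then obtain x where "x \<in> P i" "x \<in> P j" by blast
        then have "card {i, j} \<le> card {i\<in>{1..m}. x \<in> P i}"
          using that by (intro card_mono) auto
        with c[of x] \<open>i \<noteq> j\<close> show False by (auto split: if_splits)
      qed
      moreover have "x \<in> (\<Union>i\<in>{1..m}. P i)" if "x \<in> \<A>" for x
      proof -
        have "{i\<in>{1..m}. x \<in> P i} \<noteq> {}" using c[of x] that by (metis card.empty zero_neq_one)
        then show ?thesis by blast
      qed
      ultimately show "disjoint_family_on P {1..m} \<and> (\<Union>i\<in>{1..m}. P i) = \<A>"
        using sub unfolding disjoint_family_on_def by blast
    next
      assume R: "disjoint_family_on P {1..m} \<and> (\<Union>i\<in>{1..m}. P i) = \<A>"
      show "mset_set \<A> = (\<Sum>i\<in>{1..m}. mset_set (P i))"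
      proof (rule multiset_eqI)
        fix x
        have "card {i\<in>{1..m}. x \<in> P i} = (if x \<in> \<A> then 1 else 0)"
        proof (cases "x \<in> \<A>")
          case True
          then obtain i where i: "i \<in> {1..m}" "x \<in> P i" using R by blast
          then have "{i\<in>{1..m}. x \<in> P i} = {i}"
            using R unfolding disjoint_family_on_def by blast
          then show ?thesis using True by simp
        next
          case False
          then have "{i\<in>{1..m}. x \<in> P i} = {}" using R by blast
          then show ?thesis using False by (metis card.empty)
        qed
        then show "count (mset_set \<A>) x = count (\<Sum>i\<in>{1..m}. mset_set (P i)) x"
          using cnt[of x] assms by (simp add: count_mset_set')
      qed
    qed
  qed
  then show ?thesis
    unfolding resolution_def parallel_class_mset_set[OF assms] by blast
qed

end

(* Identify the points with the pairs (k, f), k < n and f a word of length m over b letters. The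
   blocks of the i-th parallel class are the sets of points whose word has a given i-th letter, and
   one block from each class determines the whole word, leaving the n choices of k. *)
theory Submission
  imports Defs "HOL-Library.FuncSet"
begin

text \<open>The labelling \<open>h\<close> is an arbitrary bijection, so \<open>X\<close> can be an
  interval of naturals rather than the set of pairs itself. Words are extensional on
  \<open>I\<close>, so there are exactly \<open>b ^ card I\<close> of them.\<close>

locale labelled_points =
  fixes X :: "'a set" and I :: "'i set" and n b :: nat and h :: "'a \<Rightarrow> nat \<times> ('i \<Rightarrow> nat)"
  assumes finite_I: "finite I" and n_pos: "n > 0" and b_pos: "b > 0"
    and h: "bij_betw h X ({..<n} \<times> (I \<rightarrow>\<^sub>E {..<b}))"
begin

definition block :: "'i \<Rightarrow> nat \<Rightarrow> 'a set" where
  "block i j = {x \<in> X. snd (h x) i = j}"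

definition blocks :: "'i \<Rightarrow> 'a set set" where
  "blocks i = block i ` {..<b}"

text \<open>Restricting the letters position by position cuts out a box of labels, and
  \<open>h\<close> preserves its size. Block sizes and cross intersections are both
  instances.\<close>

lemma card_points:
  assumes S: "\<And>i. i \<in> I \<Longrightarrow> S i \<subseteq> {..<b}"
  shows "card {x \<in> X. \<forall>i\<in>I. snd (h x) i \<in> S i} = n * (\<Prod>i\<in>I. card (S i))"
proof -
  let ?Y = "{x \<in> X. \<forall>i\<in>I. snd (h x) i \<in> S i}"
  have sub: "PiE I S \<subseteq> I \<rightarrow>\<^sub>E {..<b}"
    using S by (rule PiE_mono)
  have "h ` ?Y = {..<n} \<times> PiE I S"
  proof
    show "h ` ?Y \<subseteq> {..<n} \<times> PiE I S"
    proof
      fix y assume "y \<in> h ` ?Y"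
      then obtain x where x: "x \<in> X" "\<forall>i\<in>I. snd (h x) i \<in> S i" "y = h x" by blast
      then have "h x \<in> {..<n} \<times> (I \<rightarrow>\<^sub>E {..<b})"
        using h bij_betwE by blast
      with x show "y \<in> {..<n} \<times> PiE I S"
        by (cases "h x") (auto simp: PiE_iff)
    qed
    show "{..<n} \<times> PiE I S \<subseteq> h ` ?Y"
    proof
      fix y assume y: "y \<in> {..<n} \<times> PiE I S"
      then have "y \<in> h ` X"
        using sub bij_betw_imp_surj_on[OF h] by auto
      then obtain x where "x \<in> X" "y = h x" by blast
      with y show "y \<in> h ` ?Y" by (intro image_eqI[of _ _ x]) (auto simp: PiE_iff)
    qed
  qed
  moreover have "inj_on h ?Y"
    using h by (auto simp: bij_betw_def intro: inj_on_subset)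
  ultimately have "card ?Y = card ({..<n} \<times> PiE I S)"
    using card_image[of h ?Y] by (simp only:)
  then show ?thesis
    using finite_I by (simp add: card_cartesian_product card_PiE)
qed

lemma letter_less: "x \<in> X \<Longrightarrow> i \<in> I \<Longrightarrow> snd (h x) i < b"
  using bij_betwE[OF h] by fastforce

lemma card_block:
  assumes "i \<in> I" "j < b"
  shows "card (block i j) = n * b ^ (card I - 1)"
proof -
  \<comment> \<open>A block is the box with one letter fixed and the others free; the free positions
    impose nothing since all letters lie below \<open>b\<close>.\<close>
  have "block i j = {x \<in> X. \<forall>l\<in>I. snd (h x) l \<in> (if l = i then {j} else {..<b})}"
    using assms letter_less by (auto simp: block_def)
  then have "card (block i j) = n * (\<Prod>l\<in>I. card (if l = i then {j} else {..<b}))"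
    using assms by (simp only:) (rule card_points, auto)
  also have "(\<Prod>l\<in>I. card (if l = i then {j} else {..<b})) = (\<Prod>l\<in>I. if l = i then 1 else b)"
    by (rule prod.cong) auto
  also have "\<dots> = b ^ (card I - 1)"
    using assms finite_I by (simp add: prod.delta_remove)
  finally show ?thesis .
qed

lemma card_block_Inter:
  assumes I: "I \<noteq> {}" and j: "\<And>i. i \<in> I \<Longrightarrow> j i < b"
  shows "card (\<Inter>i\<in>I. block i (j i)) = n"
proof -
  \<comment> \<open>\<open>I \<noteq> {}\<close> keeps the intersection inside \<open>X\<close>;
    over an empty index set it would be \<open>UNIV\<close>.\<close>
  have "(\<Inter>i\<in>I. block i (j i)) = {x \<in> X. \<forall>i\<in>I. snd (h x) i \<in> {j i}}"
    using I by (auto simp: block_def)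
  also have "card \<dots> = n"
    using j by (subst card_points) auto
  finally show ?thesis .
qed

lemma block_nonempty: "i \<in> I \<Longrightarrow> j < b \<Longrightarrow> block i j \<noteq> {}"
  using card_block[of i j] n_pos b_pos by auto

text \<open>Blocks are nonempty, and any point of a block reveals its letter at position
  \<open>i\<close>.\<close>

lemma inj_on_block:
  assumes "i \<in> I"
  shows "inj_on (block i) {..<b}"
proof (rule inj_onI)
  fix j j' assume j: "j \<in> {..<b}" and eq: "block i j = block i j'"
  obtain x where "x \<in> block i j"
    using block_nonempty[of i j] assms j by auto
  with eq show "j = j'" by (auto simp: block_def)
qed

lemma finite_blocks: "finite (blocks i)"
  by (simp add: blocks_def)

lemma card_blocks: "i \<in> I \<Longrightarrow> card (blocks i) = b"
  by (simp add: blocks_def card_image inj_on_block)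

lemma partition_on_blocks:
  assumes "i \<in> I"
  shows "partition_on X (blocks i)"
proof (rule partition_onI)
  show "\<Union> (blocks i) = X"
    using assms letter_less by (auto simp: blocks_def block_def)
  show "{} \<notin> blocks i"
    using assms block_nonempty by (auto simp: blocks_def)
qed (auto simp: blocks_def block_def disjnt_def)

text \<open>A point with letter \<open>j\<close> at \<open>i\<close> and a letter other than
  \<open>j'\<close> at \<open>i'\<close> separates the blocks. Such a letter requires
  \<open>b > 1\<close>; for \<open>b = 1\<close> every block is all of \<open>X\<close>.\<close>

lemma block_neq:
  assumes "b > 1" "i \<in> I" "i' \<in> I" "i \<noteq> i'" "j < b" "j' < b"
  shows "block i j \<noteq> block i' j'"
proof -
  \<comment> \<open>Any letter other than \<open>j'\<close> would do; \<open>b > 1\<close> puts both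
    0 and 1 in the alphabet.\<close>
  define k where "k = (if j' = 0 then 1 else 0 :: nat)"
  have k: "k < b" "k \<noteq> j'" using assms by (auto simp: k_def)
  have "card (\<Inter>l\<in>I. block l (if l = i then j else k)) = n"
    using assms k by (intro card_block_Inter) auto
  then obtain x where "x \<in> (\<Inter>l\<in>I. block l (if l = i then j else k))"
    using n_pos by (metis card.empty equals0I less_irrefl)
  then have "x \<in> block i (if i = i then j else k)" "x \<in> block i' (if i' = i then j else k)"
    using assms by blast+
  then have "x \<in> block i j" "x \<in> block i' k"
    using assms by auto
  with k show ?thesis by (auto simp: block_def)
qed

lemma disjoint_family_on_blocks:
  assumes "b > 1"
  shows "disjoint_family_on blocks I"
  unfolding disjoint_family_on_def
proof (intro ballI impI, rule ccontr)
  fix i i' assume i: "i \<in> I" "i' \<in> I" "i \<noteq> i'" and "blocks i \<inter> blocks i' \<noteq> {}"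
  then obtain j j' where "j < b" "j' < b" "block i j = block i' j'"
    unfolding blocks_def by blast
  with block_neq[OF assms i] show False by blast
qed

end

theorem theorem1:
  fixes m n b :: nat
  assumes "m > 0" and "n > 0" and "b > 0"
  shows "\<exists>(A :: nat set multiset) (P :: nat \<Rightarrow> nat set set).
    maximal_cross_resolvable {1..n * b ^ m} A m P \<and>
    size A = m * b \<and>
    (\<forall>i\<in>{1..m}. card (P i) = b) \<and>
    cross_intersection_number m P n \<and>
    (b > 1 \<or> m = 1 \<longrightarrow> A = mset_set (set_mset A))"
proof -
  let ?I = "{1..m}"
  define X where "X = {1..n * b ^ m}"
  have "finite X"
    by (simp add: X_def)
  \<comment> \<open>Equal cardinality, here \<open>n * b ^ m\<close>, is all that is needed to
    obtain a labelling.\<close>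
  have "card X = card ({..<n} \<times> (?I \<rightarrow>\<^sub>E {..<b}))"
    by (simp add: X_def card_cartesian_product card_PiE)
  then obtain h where "bij_betw h X ({..<n} \<times> (?I \<rightarrow>\<^sub>E {..<b}))"
    using finite_same_card_bij[of X "{..<n} \<times> (?I \<rightarrow>\<^sub>E {..<b})"] \<open>finite X\<close>
    by (auto intro: finite_PiE)
  then interpret labelled_points X ?I n b h
    using assms by unfold_locales auto
  \<comment> \<open>The multiset sum keeps repetitions: for \<open>b = 1\<close> the block
    \<open>X\<close> occurs \<open>m\<close> times, so the size is still
    \<open>m * b\<close>.\<close>
  define A where "A = (\<Sum>i\<in>?I. mset_set (blocks i))"
  have mem_A: "B \<in># A \<longleftrightarrow> (\<exists>i\<in>?I. B \<in> blocks i)" for B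
    by (simp add: A_def set_mset_sum finite_blocks)
  have card_A: "card B = n * b ^ (m - 1)" if "B \<in># A" for B
    using that card_block unfolding mem_A by (auto simp: blocks_def)
  have "design X A"
    unfolding design_def
    using card_A \<open>finite X\<close> by (auto simp: mem_A blocks_def block_def)
  moreover have part: "parallel_class X A (blocks i)" if "i \<in> ?I" for i
  proof -
    \<comment> \<open>Splitting off one summand exhibits the class as a submultiset of
      \<open>A\<close>.\<close>
    have "A = mset_set (blocks i) + (\<Sum>l\<in>?I - {i}. mset_set (blocks l))"
      unfolding A_def using that by (intro sum.remove) auto
    then show ?thesis
      using partition_on_blocks[OF that] finite_blocks by (simp add: parallel_class_def)
  qed
  then have "resolution X A m blocks"
    using assms by (simp add: resolution_def A_def)
  moreover have cross: "cross_intersection_number m blocks n"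
    unfolding cross_intersection_number_def
  proof (intro allI impI)
    fix B assume "\<forall>i\<in>?I. B i \<in> blocks i"
    then have "\<forall>i\<in>?I. \<exists>j. j < b \<and> B i = block i j"
      by (auto simp: blocks_def)
    \<comment> \<open>The chosen blocks spell a word \<open>j\<close>, which reduces the claim to
      \<open>card_block_Inter\<close>.\<close>
    then obtain j where j: "\<forall>i\<in>?I. j i < b \<and> B i = block i (j i)"
      by metis
    then have "(\<Inter>i\<in>?I. B i) = (\<Inter>i\<in>?I. block i (j i))"
      by simp
    then show "card (\<Inter>i\<in>?I. B i) = n"
      using card_block_Inter[of j] j assms by simp
  qed
  ultimately have "maximal_cross_resolvable X A m blocks"
    using assms by (auto simp: maximal_cross_resolvable_def)
  moreover have "size A = m * b"
    by (simp add: A_def size_multiset_sum card_blocks)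
  moreover have "A = mset_set (set_mset A)" if "b > 1 \<or> m = 1"
  proof -
    have "disjoint_family_on blocks ?I"
      \<comment> \<open>For \<open>m = 1\<close> there is only one class, so disjointness is
        vacuous.\<close>
      using that disjoint_family_on_blocks by (auto simp: disjoint_family_on_def)
    \<comment> \<open>Read from right to left, \<open>resolution_mset_set\<close> turns disjointness
      of the classes into the multiset equation that identifies \<open>A\<close>.\<close>
    then have "resolution X (mset_set (\<Union>i\<in>?I. blocks i)) m blocks"
      using assms finite_blocks partition_on_blocks by (subst resolution_mset_set) auto
    then have "A = mset_set (\<Union>i\<in>?I. blocks i)"
      by (simp add: resolution_def A_def)
    then show ?thesis
      using finite_blocks by simp
  qed
  ultimately show ?thesis
    using cross card_blocks unfolding X_def by blast
qed

end
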